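(* Let $A\in\mathbb{R}^{m\times n}$ with $\operatorname{rank}(A)\ge 2$, let $b\in\mathbb{R}^m$, and suppose that the linear system $Ax=b$ is consistent. Let $r$ be a positive integer, let $x^1=x^0\in\mathbb{R}^n$ be arbitrary initial vectors, and let $x_0^*=A^{\dagger}b+(I-A^\dagger A)x^0$. Assume $0<\alpha<1$, $\beta\geq0$ and that $$\gamma_1:=\alpha^2+(1-\alpha)^2+\left(2\alpha(1-\alpha)+3\alpha\beta\right)\left(1-2\frac{\sigma_{\min}^2(A)}{\|A\|^2_F}\right)^r+2\beta^2+3(1-\alpha)\beta$$ and $$\gamma_2:=2\beta^2+(1-\alpha)\beta+\alpha\beta\left(1-2\frac{\sigma_{\min}^2(A)}{\|A\|^2_F}\right)^r$$ satisfy $\gamma_1+\gamma_2<1$. Then the iteration sequence $\{x^k\}_{k=0}^{\infty}$ generated by the randomized $r$-sets-Douglas-Rachford method with momentum (mRrDR) satisfies $$\mathbb{E}\left[\|x^{k+1}-x_{0}^*\|^2_2\right]\leq q^k(1+\tau)\|x^0-x_{0}^*\|^2_2,\quad\forall\, k\geq 0,$$ where $q=\frac{\gamma_1+\sqrt{\gamma_1^2+4\gamma_2}}{2}$ and $\tau=q-\gamma_1\geq 0$. Moreover, $\gamma_1+\gamma_2\leq q<1$.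
   Context: Notation: $a_1^\top,\dots,a_m^\top$ are the rows of $A$, $b=(b_1,\dots,b_m)^\top$, $A^\dagger$ is the Moore-Penrose pseudoinverse, $\|A\|_F$ the Frobenius norm, and $\sigma_{\min}(A)$ the smallest nonzero singular value of $A$. mRrDR method: given (deterministic) initial vectors $x^0,x^1\in\mathbb{R}^n$, a positive integer $r$, a relaxation parameter $\alpha$ and a momentum parameter $\beta$, for each $k=1,2,\dots$ set $z_0^k:=x^k$; for $\ell=1,\dots,r$ select a random index $j_{k_\ell}\in\{1,\dots,m\}$, independently of all other selections, with $\Pr(j_{k_\ell}=i)=\|a_i\|_2^2/\|A\|_F^2$ (so zero rows are never selected), and set $$z_\ell^k:=z_{\ell-1}^k-2\frac{\langle a_{j_{k_\ell}},z_{\ell-1}^k\rangle-b_{j_{k_\ell}}}{\|a_{j_{k_\ell}}\|_2^2}\,a_{j_{k_\ell}};$$ then set $x^{k+1}:=(1-\alpha)x^k+\alpha z_r^k+\beta(x^k-x^{k-1})$. The expectation is over all random row selections. *)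

theory Defs
  imports "HOL-Probability.Probability"
begin

definition frobenius_norm :: "real^'n^'m \<Rightarrow> real" where
  "frobenius_norm A = sqrt (\<Sum>i\<in>UNIV. \<Sum>j\<in>UNIV. (A $ i $ j)\<^sup>2)"

text \<open>The four Penrose conditions, which determine the pseudoinverse uniquely.\<close>

definition is_pseudoinverse :: "real^'n^'m \<Rightarrow> real^'m^'n \<Rightarrow> bool" where
  "is_pseudoinverse A X \<longleftrightarrow>
     A ** X ** A = A \<and> X ** A ** X = X \<and>
     transpose (A ** X) = A ** X \<and> transpose (X ** A) = X ** A"

definition pseudoinverse :: "real^'n^'m \<Rightarrow> real^'m^'n" where
  "pseudoinverse A = (THE X. is_pseudoinverse A X)"

text \<open>
  Singular values are the nonnegative square roots of the eigenvalues of \<open>A\<^sup>T A\<close>.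
  Using \<open>A A\<^sup>T\<close> instead could only change whether \<open>0\<close> is a singular value.
\<close>

definition singular_value :: "real^'n^'m \<Rightarrow> real \<Rightarrow> bool" where
  "singular_value A s \<longleftrightarrow>
     0 \<le> s \<and> (\<exists>v. v \<noteq> 0 \<and> (transpose A ** A) *v v = s\<^sup>2 *\<^sub>R v)"

text \<open>The smallest nonzero singular value; meaningful only for \<open>A \<noteq> 0\<close>.\<close>

definition sigma_min :: "real^'n^'m \<Rightarrow> real" where
  "sigma_min A = Min {s. singular_value A s \<and> s \<noteq> 0}"

definition row_reflection ::
    "real^'n^'m \<Rightarrow> real^'m \<Rightarrow> 'm \<Rightarrow> real^'n \<Rightarrow> real^'n" where
  "row_reflection A b i z =
     z - (2 * ((row i A \<bullet> z - b $ i) / (norm (row i A))\<^sup>2)) *\<^sub>R row i A"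

text \<open>
  \<open>inner_iterate A b js z l\<close> is the inner iterate \<open>z\<^sub>l\<close> started at \<open>z\<^sub>0 = z\<close>, where
  \<open>js l\<close> is the row index selected in inner step \<open>l \<ge> 1\<close>; \<open>js 0\<close> is never used.
\<close>

primrec inner_iterate ::
    "real^'n^'m \<Rightarrow> real^'m \<Rightarrow> (nat \<Rightarrow> 'm) \<Rightarrow> real^'n \<Rightarrow> nat \<Rightarrow> real^'n" where
  "inner_iterate A b js z 0 = z"
| "inner_iterate A b js z (Suc l) =
     row_reflection A b (js (Suc l)) (inner_iterate A b js z l)"

text \<open>
  \<open>mRrDR A b r \<alpha> \<beta> x0 x1 j k\<close> is the outer iterate \<open>x\<^sup>k\<close> for a given realization of
  the row selections, \<open>j k l\<close> being the index selected in inner step \<open>l\<close> of outer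
  step \<open>k \<ge> 1\<close>.
\<close>

fun mRrDR ::
    "real^'n^'m \<Rightarrow> real^'m \<Rightarrow> nat \<Rightarrow> real \<Rightarrow> real \<Rightarrow> real^'n \<Rightarrow> real^'n \<Rightarrow>
     (nat \<Rightarrow> nat \<Rightarrow> 'm) \<Rightarrow> nat \<Rightarrow> real^'n" where
  "mRrDR A b r \<alpha> \<beta> x0 x1 j 0 = x0"
| "mRrDR A b r \<alpha> \<beta> x0 x1 j (Suc 0) = x1"
| "mRrDR A b r \<alpha> \<beta> x0 x1 j (Suc (Suc k)) =
     (let x = mRrDR A b r \<alpha> \<beta> x0 x1 j (Suc k) in
        (1 - \<alpha>) *\<^sub>R x
        + \<alpha> *\<^sub>R inner_iterate A b (j (Suc k)) x r
        + \<beta> *\<^sub>R (x - mRrDR A b r \<alpha> \<beta> x0 x1 j k))"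

text \<open>
  The random selections \<open>J k l\<close> (\<open>k \<ge> 1\<close>, \<open>1 \<le> l \<le> r\<close>) on a probability space \<open>M\<close>:
  mutually independent, each choosing row \<open>i\<close> with probability proportional to its
  squared norm. Independence includes measurability of each \<open>J k l\<close>.
\<close>

definition row_selections ::
    "'w measure \<Rightarrow> real^'n^'m \<Rightarrow> nat \<Rightarrow> (nat \<Rightarrow> nat \<Rightarrow> 'w \<Rightarrow> 'm) \<Rightarrow> bool" where
  "row_selections M A r J \<longleftrightarrow>
     prob_space M \<and>
     prob_space.indep_vars M (\<lambda>_. count_space UNIV) (\<lambda>(k, l). J k l) ({1..} \<times> {1..r}) \<and>
     (\<forall>k\<ge>1. \<forall>l\<in>{1..r}. \<forall>i.
        measure M {w \<in> space M. J k l w = i} = (norm (row i A))\<^sup>2 / (frobenius_norm A)\<^sup>2)"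

end

theory Submission
  imports Defs
begin

text \<open>
  Write \<open>e\<^sub>k = x\<^sup>k - xs\<close>. Since \<open>xs\<close> solves the system, every reflecting hyperplane contains \<open>xs\<close>,
  and the inner loop turns \<open>e\<^sub>k\<close> into \<open>T e\<^sub>k\<close>, where \<open>T\<close> is a product of \<open>r\<close> independent linear
  reflections in hyperplanes orthogonal to rows of \<open>A\<close>. Thus
  \<open>e\<^sub>k\<^sub>+\<^sub>1 = (1 - \<alpha> + \<beta>) e\<^sub>k + \<alpha> T e\<^sub>k - \<beta> e\<^sub>k\<^sub>-\<^sub>1\<close> with \<open>\<parallel>T e\<^sub>k\<parallel> = \<parallel>e\<^sub>k\<parallel>\<close>. Since \<open>xs\<close> is the projection of
  \<open>x0\<close> onto the solution set, \<open>e\<^sub>0\<close> lies in the row space of \<open>A\<close>, and so do all errors.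

  Expand the square of the norm of \<open>e\<^sub>k\<^sub>+\<^sub>1\<close>. As \<open>T\<close> is an isometry, it survives only in the inner
  products of \<open>T e\<^sub>k\<close> with \<open>e\<^sub>k\<close> and with \<open>e\<^sub>k\<^sub>-\<^sub>1\<close>, which are linear in \<open>T\<close>. Its selections are
  independent of both errors, so in expectation \<open>T\<close> may be replaced by \<open>S\<^sup>r\<close>, where
  \<open>S = I - 2 A\<^sup>T A / \<parallel>A\<parallel>\<^sub>F\<^sup>2\<close> is the mean of a single reflection
  (\<open>expectation_inner_iterate\<close>).

  On the row space \<open>S\<close> has norm at most \<open>c = 1 - 2 \<sigma>\<^sub>m\<^sub>i\<^sub>n\<^sup>2 / \<parallel>A\<parallel>\<^sub>F\<^sup>2\<close> (\<open>norm_mean_reflection_le\<close>). The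
  minimum of \<open>\<parallel>A v\<parallel>\<^sup>2\<close> over unit vectors \<open>v\<close> of
  the row space is a nonzero squared singular value, hence at least \<open>\<sigma>\<^sub>m\<^sub>i\<^sub>n\<^sup>2\<close>. The rank is at least
  2, so for each unit \<open>v\<close> there is an orthogonal unit vector \<open>w\<close> in the row space, and
  \<open>\<parallel>A v\<parallel>\<^sup>2 \<le> \<parallel>A\<parallel>\<^sub>F\<^sup>2 - \<parallel>A w\<parallel>\<^sup>2 \<le> \<parallel>A\<parallel>\<^sub>F\<^sup>2 - \<sigma>\<^sub>m\<^sub>i\<^sub>n\<^sup>2\<close>. Together they bound the quadratic form of \<open>S\<close> by
  \<open>\<plusminus>c\<close>, and \<open>S\<close> is symmetric.

  Cauchy-Schwarz and the inequality \<open>2 x y \<le> x\<^sup>2 + y\<^sup>2\<close> then give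
  \<open>E \<parallel>e\<^sub>k\<^sub>+\<^sub>1\<parallel>\<^sup>2 \<le> \<gamma>\<^sub>1 E \<parallel>e\<^sub>k\<parallel>\<^sup>2 + \<gamma>\<^sub>2 E \<parallel>e\<^sub>k\<^sub>-\<^sub>1\<parallel>\<^sup>2\<close> (\<open>expected_error_recursion\<close>). The number \<open>q\<close> is
  the larger root of \<open>q\<^sup>2 = \<gamma>\<^sub>1 q + \<gamma>\<^sub>2\<close>, so \<open>q \<tau> = \<gamma>\<^sub>2\<close>, and \<open>E \<parallel>e\<^sub>k\<^sub>+\<^sub>1\<parallel>\<^sup>2 + \<tau> E \<parallel>e\<^sub>k\<parallel>\<^sup>2\<close> shrinks by
  the factor \<open>q\<close> in each step (\<open>two_term_recursion_bound\<close>).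
\<close>

section \<open>Two-term linear recursions\<close>

text \<open>
  The recursion \<open>F\<^sub>k\<^sub>+\<^sub>2 \<le> g1 F\<^sub>k\<^sub>+\<^sub>1 + g2 F\<^sub>k\<close> has characteristic equation \<open>q\<^sup>2 = g1 q + g2\<close>, that is,
  \<open>q t = g2\<close> with \<open>t = q - g1\<close>. For such \<open>q\<close> and \<open>t\<close> the quantity \<open>F\<^sub>k\<^sub>+\<^sub>1 + t F\<^sub>k\<close> shrinks by the
  factor \<open>q\<close> in each step.
\<close>

lemma two_term_recursion_bound:
  fixes F :: "nat \<Rightarrow> real" and g1 g2 q t :: real
  assumes rec: "\<And>k. F (Suc (Suc k)) \<le> g1 * F (Suc k) + g2 * F k"
    and F: "\<And>k. 0 \<le> F k"
    and q: "0 \<le> q" and t: "0 \<le> t" "t = q - g1" "q * t = g2"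
  shows "F (Suc k) \<le> q ^ k * (F 1 + t * F 0)"
proof -
  have "F (Suc k) + t * F k \<le> q ^ k * (F 1 + t * F 0)"
  proof (induction k)
    case (Suc k)
    have "F (Suc (Suc k)) + t * F (Suc k) \<le> (g1 + t) * F (Suc k) + g2 * F k"
      using rec[of k] by (simp add: algebra_simps)
    also have "\<dots> = q * (F (Suc k) + t * F k)"
      unfolding t(3)[symmetric] using t(2) by (simp add: algebra_simps)
    also have "\<dots> \<le> q * (q ^ k * (F 1 + t * F 0))"
      using Suc q by (intro mult_left_mono) auto
    finally show ?case by simp
  qed simp
  moreover have "0 \<le> t * F k" using t(1) F by simp
  ultimately show ?thesis by linarith
qed

text \<open>
  \<open>q\<close> is the larger root of \<open>q\<^sup>2 = g1 q + g2\<close>. It lies below 1 because the characteristic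
  polynomial is positive at 1 and its other root is at most 0, and then \<open>g2 = q (q - g1) \<le> q - g1\<close>.
\<close>

lemma dominant_root:
  fixes g1 g2 q :: real
  assumes g1: "0 < g1" and g2: "0 \<le> g2" and lt: "g1 + g2 < 1"
    and q: "q = (g1 + sqrt (g1\<^sup>2 + 4 * g2)) / 2"
  shows "q * (q - g1) = g2" "g1 \<le> q" "g1 + g2 \<le> q" "q < 1"
proof -
  have sq: "(sqrt (g1\<^sup>2 + 4 * g2))\<^sup>2 = g1\<^sup>2 + 4 * g2" using g2 by simp
  show root: "q * (q - g1) = g2"
    using sq unfolding q by (simp add: field_simps power2_eq_square)
  have "g1 \<le> sqrt (g1\<^sup>2 + 4 * g2)" using g1 g2 by (intro real_le_rsqrt) simp
  then show ge: "g1 \<le> q" unfolding q by simp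
  have "g1\<^sup>2 + 4 * g2 < (2 - g1)\<^sup>2" using lt by (simp add: power2_eq_square algebra_simps)
  then have "sqrt (g1\<^sup>2 + 4 * g2) < 2 - g1"
    using g2 lt by (intro real_less_lsqrt) auto
  then show lt1: "q < 1" unfolding q by simp
  have "q * (q - g1) \<le> 1 * (q - g1)" using ge lt1 by (intro mult_right_mono) auto
  then show "g1 + g2 \<le> q" using root by simp
qed

section \<open>Row space and pseudoinverse\<close>

\<comment> \<open>Keep \<open>A\<^sup>T y\<close> as a matrix-vector product; the simplifier would turn it into a row-vector product.\<close>
declare transpose_matrix_vector [simp del]

lemma transpose_inner:
  fixes A :: "real^'n^'m"
  shows "(transpose A *v y) \<bullet> x = y \<bullet> (A *v x)"
  by (simp add: transpose_matrix_vector dot_lmul_matrix)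

text \<open>
  The Penrose symmetry conditions are checked through the bilinear forms of the matrices.
\<close>

lemma symmetric_matrixI:
  fixes B :: "real^'n^'n"
  assumes "\<And>x y. (B *v x) \<bullet> y = x \<bullet> (B *v y)"
  shows "transpose B = B"
proof -
  have "transpose B *v x = B *v x" for x
    by (rule vector_eq_rdot[THEN iffD1]) (simp add: transpose_inner assms)
  then show ?thesis by (simp add: matrix_eq)
qed

lemma gram_eq_0_iff:
  fixes A :: "real^'n^'m"
  shows "transpose A *v (A *v v) = 0 \<longleftrightarrow> A *v v = 0"
proof
  assume "transpose A *v (A *v v) = 0"
  then have "(A *v v) \<bullet> (A *v v) = 0" using transpose_inner[of A "A *v v" v] by simp
  then show "A *v v = 0" by simp
qed simp

definition row_space :: "real^'n^'m \<Rightarrow> (real^'n) set" where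
  "row_space A = range ((*v) (transpose A))"

lemma subspace_row_space: "subspace (row_space A)"
  unfolding row_space_def by (intro linear_subspace_image) auto

lemma transpose_in_row_space [simp]: "transpose A *v y \<in> row_space A"
  by (simp add: row_space_def)

lemma row_in_row_space: "row i A \<in> row_space A"
proof -
  have "row i A = transpose A *v axis i 1"
    by (simp add: matrix_vector_mult_basis)
  then show ?thesis by simp
qed

text \<open>
  The row space is orthogonal to the kernel: if \<open>v = A\<^sup>T y\<close> and \<open>A v = 0\<close>, then
  \<open>v \<bullet> v = y \<bullet> A v = 0\<close>.
\<close>

lemma row_space_kernel_trivial:
  assumes "v \<in> row_space A" "A *v v = 0"
  shows "v = 0"
proof -
  obtain y where y: "v = transpose A *v y" using assms(1) by (auto simp: row_space_def)
  have "v \<bullet> v = 0" using assms(2) transpose_inner[of A y v] by (simp add: y)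
  then show ?thesis by simp
qed

text \<open>
  The least-squares problem \<open>A x \<approx> y\<close> has exactly one solution in the row space: split \<open>y\<close>
  orthogonally along the column space, and a preimage of the column-space part along the row
  space. Its row-space part is a solution, and two solutions differ by a vector of the kernel.
\<close>

lemma row_space_least_squares:
  fixes A :: "real^'n^'m"
  shows "\<exists>!x. x \<in> row_space A \<and> transpose A *v (A *v x - y) = 0"
proof (rule ex_ex1I)
  have span_col: "span (range ((*v) A)) = range ((*v) A)"
    by (intro span_eq_iff[THEN iffD2] linear_subspace_image) auto
  have span_row: "span (row_space A) = row_space A"
    by (intro span_eq_iff[THEN iffD2] subspace_row_space)
  obtain p n where p: "p \<in> range ((*v) A)" "y = p + n"
      and n: "\<And>w. w \<in> range ((*v) A) \<Longrightarrow> orthogonal n w"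
    using orthogonal_subspace_decomp_exists[of "range ((*v) A)" y] unfolding span_col by metis
  obtain x' where x': "p = A *v x'" using p(1) by auto
  obtain x d where x: "x \<in> row_space A" "x' = x + d"
      and d: "\<And>w. w \<in> row_space A \<Longrightarrow> orthogonal d w"
    using orthogonal_subspace_decomp_exists[of "row_space A" x'] unfolding span_row by metis
  have "(A *v d) \<bullet> (A *v d) = 0"
    using d[of "transpose A *v (A *v d)"] transpose_inner[of A "A *v d" d]
    by (simp add: orthogonal_def inner_commute)
  then have "p = A *v x" by (simp add: x' x(2) matrix_vector_right_distrib)
  moreover have "transpose A *v n = 0"
  proof (rule vector_eq_rdot[THEN iffD1], intro allI)
    fix z show "(transpose A *v n) \<bullet> z = 0 \<bullet> z"
      using n[of "A *v z"] by (simp add: transpose_inner orthogonal_def)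
  qed
  ultimately have "A *v x - y = 0 - n" "transpose A *v (0 - n) = 0"
    by (simp add: p(2), subst matrix_vector_mult_diff_distrib, simp)
  then have "transpose A *v (A *v x - y) = 0" by metis
  then show "\<exists>x. x \<in> row_space A \<and> transpose A *v (A *v x - y) = 0" using x(1) by blast
next
  fix x x'
  assume *: "x \<in> row_space A \<and> transpose A *v (A *v x - y) = 0"
    "x' \<in> row_space A \<and> transpose A *v (A *v x' - y) = 0"
  then have "transpose A *v (A *v (x - x')) = 0"
    by (simp add: matrix_vector_mult_diff_distrib)
  then have "A *v (x - x') = 0" by (simp add: gram_eq_0_iff)
  moreover have "x - x' \<in> row_space A" using * subspace_diff[OF subspace_row_space] by blast
  ultimately show "x = x'" using row_space_kernel_trivial by force
qed

text \<open>
  The map \<open>f\<close> sending \<open>y\<close> to its least-squares solution in the row space is linear, by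
  uniqueness of that solution. Then \<open>A f\<close> and \<open>f A\<close> are the orthogonal projections onto the
  column space and the row space, which gives the Penrose conditions.
\<close>

lemma pseudoinverse_exists:
  fixes A :: "real^'n^'m"
  shows "\<exists>X. is_pseudoinverse A X"
proof -
  define f where "f y = (THE x. x \<in> row_space A \<and> transpose A *v (A *v x - y) = 0)" for y
  have f: "f y \<in> row_space A" "transpose A *v (A *v f y - y) = 0" for y
    using theI'[OF row_space_least_squares[of A y]] unfolding f_def by auto
  have f_eqI: "f y = x" if "x \<in> row_space A" "transpose A *v (A *v x - y) = 0" for x y
    using row_space_least_squares[of A y] f[of y] that by blast
  have "linear f"
  proof (rule linearI)
    fix y z and c :: real
    show "f (y + z) = f y + f z"
      using f[of y] f[of z]
      by (intro f_eqI subspace_add[OF subspace_row_space])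
        (simp_all add: matrix_vector_right_distrib matrix_vector_mult_diff_distrib)
    show "f (c *\<^sub>R y) = c *\<^sub>R f y"
      using f[of y]
      by (intro f_eqI subspace_mul[OF subspace_row_space])
        (simp_all add: matrix_vector_mult_diff_distrib matrix_vector_mult_scaleR)
  qed
  then have X: "matrix f *v y = f y" for y by (simp add: matrix_works linear_matrix_vector_mul_eq)
  have fA: "A *v f (A *v v) = A *v v" for v
  proof -
    have "transpose A *v (A *v (f (A *v v) - v)) = 0"
      using f(2)[of "A *v v"] by (simp add: matrix_vector_mult_diff_distrib)
    then have "A *v (f (A *v v) - v) = 0" by (simp only: gram_eq_0_iff)
    then show ?thesis by (simp add: matrix_vector_mult_diff_distrib)
  qed
  \<comment> \<open>\<open>A f\<close> is self-adjoint, because the residual \<open>A f w - w\<close> is orthogonal to the column space.\<close>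
  have Af: "(A *v f y) \<bullet> w = (A *v f y) \<bullet> (A *v f w)" for y w
  proof -
    have "f y \<bullet> (transpose A *v (A *v f w - w)) = 0" by (simp add: f)
    then show ?thesis
      using transpose_inner[of A "A *v f w - w" "f y"]
      by (simp add: inner_diff_left inner_diff_right inner_commute)
  qed
  \<comment> \<open>\<open>f A\<close> is self-adjoint, because \<open>f (A w) - w\<close> lies in the kernel of \<open>A\<close>, orthogonal to the row space.\<close>
  have fAs: "f (A *v v) \<bullet> w = f (A *v v) \<bullet> f (A *v w)" for v w
  proof -
    obtain g where "f (A *v v) = transpose A *v g" using f(1) by (auto simp: row_space_def)
    then show ?thesis by (simp add: transpose_inner fA)
  qed
  have "is_pseudoinverse A (matrix f)"
    unfolding is_pseudoinverse_def
  proof (intro conjI)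
    show "A ** matrix f ** A = A"
      by (simp add: matrix_eq matrix_vector_mul_assoc[symmetric] X fA)
    have "f (A *v f y) = f y" for y using f[of y] by (intro f_eqI) auto
    then show "matrix f ** A ** matrix f = matrix f"
      by (simp add: matrix_eq matrix_vector_mul_assoc[symmetric] X)
    show "transpose (A ** matrix f) = A ** matrix f"
      by (intro symmetric_matrixI) (simp add: matrix_vector_mul_assoc[symmetric] X, metis Af inner_commute)
    show "transpose (matrix f ** A) = matrix f ** A"
      by (intro symmetric_matrixI) (simp add: matrix_vector_mul_assoc[symmetric] X, metis fAs inner_commute)
  qed
  then show ?thesis by blast
qed

text \<open>
  Symmetry forces \<open>A X = A Y\<close> and \<open>X A = Y A\<close> (transpose \<open>A X = A Y A X\<close>), whence
  \<open>X = X A X = X A Y = Y A Y = Y\<close>.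
\<close>

lemma pseudoinverse_unique:
  assumes X: "is_pseudoinverse A X" and Y: "is_pseudoinverse A Y"
  shows "X = Y"
proof -
  note x = X[unfolded is_pseudoinverse_def] and y = Y[unfolded is_pseudoinverse_def]
  have "A ** X = transpose (A ** Y ** A ** X)" using x y by (metis)
  also have "\<dots> = transpose (A ** X) ** transpose (A ** Y)"
    by (simp add: matrix_transpose_mul matrix_mul_assoc)
  also have "\<dots> = A ** Y" using x y by (metis matrix_mul_assoc)
  finally have AX: "A ** X = A ** Y" .
  have "X ** A = transpose (X ** A ** Y ** A)" using x y by (metis matrix_mul_assoc)
  also have "\<dots> = transpose (Y ** A) ** transpose (X ** A)"
    by (simp add: matrix_transpose_mul matrix_mul_assoc)
  also have "\<dots> = Y ** A" using x y by (metis matrix_mul_assoc)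
  finally have XA: "X ** A = Y ** A" .
  have "X = X ** (A ** X)" using x by (simp add: matrix_mul_assoc)
  also have "\<dots> = X ** A ** Y" unfolding AX by (simp add: matrix_mul_assoc)
  also have "\<dots> = Y" unfolding XA using y by simp
  finally show ?thesis .
qed

lemma is_pseudoinverse_pseudoinverse: "is_pseudoinverse A (pseudoinverse A)"
  unfolding pseudoinverse_def
  using pseudoinverse_exists pseudoinverse_unique by (metis (mono_tags, lifting) theI')

text \<open>
  The reference point is the projection of \<open>x0\<close> onto the solution set. What matters is that
  it solves the system and that the initial error lies in the row space.
\<close>

lemma pseudoinverse_projection:
  fixes A :: "real^'n^'m"
  assumes "\<exists>x. A *v x = b"
    and xs: "xs = pseudoinverse A *v b + (mat 1 - pseudoinverse A ** A) *v x0"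
  shows "A *v xs = b" "x0 - xs \<in> row_space A"
proof -
  let ?X = "pseudoinverse A"
  have P: "A ** ?X ** A = A" "transpose (?X ** A) = ?X ** A"
    using is_pseudoinverse_pseudoinverse[of A] by (auto simp: is_pseudoinverse_def)
  obtain x where x: "A *v x = b" using assms(1) by blast
  have xs': "xs = x0 - (?X ** A) *v (x0 - x)"
    by (simp add: xs x[symmetric] matrix_vector_mult_diff_rdistrib
        matrix_vector_mult_diff_distrib matrix_vector_mul_assoc algebra_simps)
  show "A *v xs = b"
    unfolding xs' by (simp add: matrix_vector_mult_diff_distrib matrix_vector_mul_assoc P(1)
        matrix_mul_assoc x)
  have "x0 - xs = transpose (?X ** A) *v (x0 - x)" using P(2) by (simp add: xs')
  then show "x0 - xs \<in> row_space A"
    by (simp add: matrix_transpose_mul matrix_vector_mul_assoc[symmetric])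
qed

section \<open>Smallest singular value and the Rayleigh quotient\<close>

text \<open>
  Eigenvectors of \<open>A\<^sup>T A\<close> for distinct eigenvalues are orthogonal, hence independent, so there
  are only finitely many.
\<close>

lemma gram_eigenvalues_finite:
  fixes A :: "real^'n^'m"
  shows "finite {c :: real. \<exists>v. v \<noteq> 0 \<and> transpose A *v (A *v v) = c *\<^sub>R v}"
    (is "finite ?E")
proof -
  have "\<exists>ev. \<forall>c\<in>?E. ev c \<noteq> 0 \<and> transpose A *v (A *v ev c) = c *\<^sub>R ev c"
    by (intro bchoice) simp
  then obtain ev
    where ev: "\<And>c. c \<in> ?E \<Longrightarrow> ev c \<noteq> 0 \<and> transpose A *v (A *v ev c) = c *\<^sub>R ev c"
    by blast
  have orth: "ev c \<bullet> ev d = 0" if "c \<in> ?E" "d \<in> ?E" "c \<noteq> d" for c d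
  proof -
    have "c * (ev c \<bullet> ev d) = (transpose A *v (A *v ev c)) \<bullet> ev d"
      using ev[OF that(1)] by simp
    also have "\<dots> = (transpose A *v (A *v ev d)) \<bullet> ev c"
      unfolding transpose_inner by (rule inner_commute)
    also have "\<dots> = d * (ev c \<bullet> ev d)"
      using ev[OF that(2)] by (simp add: inner_commute)
    finally show ?thesis using that(3) by simp
  qed
  have inj: "inj_on ev ?E"
  proof (rule inj_onI, rule ccontr)
    fix c d assume "c \<in> ?E" "d \<in> ?E" "ev c = ev d" "c \<noteq> d"
    then show False using orth[of c d] ev[of d] by simp
  qed
  have "independent (ev ` ?E)"
  proof (rule pairwise_orthogonal_independent)
    show "pairwise orthogonal (ev ` ?E)"
      unfolding pairwise_def orthogonal_def using orth by blast
    show "0 \<notin> ev ` ?E" using ev by force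
  qed
  then have "finite (ev ` ?E)" using independent_bound by blast
  then show ?thesis using inj finite_imageD by blast
qed

text \<open>
  The \<open>Min\<close> in \<^const>\<open>sigma_min\<close> is specified only on finite sets.
\<close>

lemma finite_singular_values: "finite {s. singular_value A s \<and> s \<noteq> 0}"
proof -
  let ?E = "{c :: real. \<exists>v. v \<noteq> 0 \<and> transpose A *v (A *v v) = c *\<^sub>R v}"
  have "{s. singular_value A s \<and> s \<noteq> 0} \<subseteq> sqrt ` ?E"
  proof
    fix s assume "s \<in> {s. singular_value A s \<and> s \<noteq> 0}"
    then have "s = sqrt (s\<^sup>2)" "s\<^sup>2 \<in> ?E"
      by (auto simp: singular_value_def matrix_vector_mul_assoc)
    then show "s \<in> sqrt ` ?E" by blast
  qed
  then show ?thesis using gram_eigenvalues_finite finite_surj by blast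
qed

text \<open>
  First-order optimality: a quadratic without constant term that is nowhere negative has no
  linear term.
\<close>

lemma linear_coefficient_zero:
  fixes a b :: real
  assumes "\<And>t. 0 \<le> a * t\<^sup>2 + 2 * b * t"
  shows "b = 0"
proof (rule ccontr)
  assume b: "b \<noteq> 0"
  define d where "d = \<bar>a\<bar> + 1"
  have d: "0 < d" "a < 2 * d" by (auto simp: d_def)
  \<comment> \<open>At \<open>t = - b / d\<close> the linear term dominates, since \<open>d > \<bar>a\<bar> / 2\<close>.\<close>
  have "a * (- b / d)\<^sup>2 + 2 * b * (- b / d) = (b\<^sup>2 / d\<^sup>2) * (a - 2 * d)"
    using d by (simp add: field_simps power2_eq_square)
  also have "\<dots> < 0" using d b by (intro mult_pos_neg) auto
  finally show False using assms[of "- b / d"] by linarith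
qed

text \<open>
  On the compact unit sphere of the row space, \<open>\<parallel>A v\<parallel>\<^sup>2\<close> attains a minimum \<open>c\<close>, which is
  positive because \<open>A\<close> is injective on the row space. The gradient condition at a minimizer
  \<open>v\<close>, tested in the direction \<open>g = A\<^sup>T A v - c v\<close> that itself lies in the row space, says \<open>g \<bullet> g = 0\<close>.
\<close>

lemma rayleigh_minimum_is_eigenvalue:
  fixes A :: "real^'n^'m"
  assumes ne: "row_space A \<noteq> {0}"
  obtains v c where "v \<in> row_space A" "norm v = 1" "c > 0"
    "transpose A *v (A *v v) = c *\<^sub>R v"
    "\<And>w. w \<in> row_space A \<Longrightarrow> c * (norm w)\<^sup>2 \<le> (norm (A *v w))\<^sup>2"
proof -
  let ?W = "row_space A"
  let ?K = "?W \<inter> sphere 0 1"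
  have sub: "subspace ?W" by (rule subspace_row_space)
  have normalize: "(1 / norm w) *\<^sub>R w \<in> ?K" if "w \<in> ?W" "w \<noteq> 0" for w
    using that subspace_mul[OF sub] by auto
  have "compact ?K" using closed_subspace[OF sub] by (intro closed_Int_compact) auto
  moreover obtain w where "w \<in> ?W" "w \<noteq> 0" using ne subspace_0[OF sub] by blast
  then have "?K \<noteq> {}" using normalize by blast
  moreover have "continuous_on ?K (\<lambda>w. (norm (A *v w))\<^sup>2)"
    by (intro continuous_intros matrix_vector_mult_linear_continuous_on)
  ultimately obtain v where v: "v \<in> ?K"
      and min: "\<And>w. w \<in> ?K \<Longrightarrow> (norm (A *v v))\<^sup>2 \<le> (norm (A *v w))\<^sup>2"
    using continuous_attains_inf by metis
  define c where "c = (norm (A *v v))\<^sup>2"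
  have vW: "v \<in> ?W" and v1: "norm v = 1" using v by auto
  have lower: "c * (norm w)\<^sup>2 \<le> (norm (A *v w))\<^sup>2" if "w \<in> ?W" for w
  proof (cases "w = 0")
    case False
    have "c \<le> (norm (A *v ((1 / norm w) *\<^sub>R w)))\<^sup>2"
      unfolding c_def by (intro min normalize that False)
    then show ?thesis
      using False by (simp add: matrix_vector_mult_scaleR power_divide field_simps)
  qed simp
  have "v \<noteq> 0" using v1 by auto
  then have "A *v v \<noteq> 0" using row_space_kernel_trivial[OF vW] by blast
  then have "c > 0" by (simp add: c_def)
  define g where "g = transpose A *v (A *v v) - c *\<^sub>R v"
  have gW: "g \<in> ?W" unfolding g_def by (intro subspace_diff[OF sub] subspace_mul[OF sub] vW) simp
  have "g \<bullet> g = 0"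
  proof (rule linear_coefficient_zero)
    fix t :: real
    have "v + t *\<^sub>R g \<in> ?W" by (intro subspace_add[OF sub] subspace_mul[OF sub] vW gW)
    from lower[OF this]
    have "0 \<le> (A *v (v + t *\<^sub>R g)) \<bullet> (A *v (v + t *\<^sub>R g))
              - c * ((v + t *\<^sub>R g) \<bullet> (v + t *\<^sub>R g))"
      by (simp add: power2_norm_eq_inner)
    also have "\<dots> = ((norm (A *v g))\<^sup>2 - c * (norm g)\<^sup>2) * t\<^sup>2
        + 2 * ((A *v v) \<bullet> (A *v g) - c * (v \<bullet> g)) * t + (c - c * (norm v)\<^sup>2)"
      unfolding c_def power2_norm_eq_inner
      by (simp add: matrix_vector_right_distrib
          matrix_vector_mult_scaleR inner_simps inner_commute[of g v]
          inner_commute[of "A *v g" "A *v v"] algebra_simps power2_eq_square)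
    also have "(A *v v) \<bullet> (A *v g) - c * (v \<bullet> g) = g \<bullet> g"
      by (simp add: transpose_inner[symmetric] g_def inner_diff_left)
    finally show "0 \<le> ((norm (A *v g))\<^sup>2 - c * (norm g)\<^sup>2) * t\<^sup>2 + 2 * (g \<bullet> g) * t"
      by (simp add: v1)
  qed
  then have "transpose A *v (A *v v) = c *\<^sub>R v" by (simp add: g_def)
  with that vW v1 \<open>c > 0\<close> lower show thesis by blast
qed

text \<open>
  The minimum of the Rayleigh quotient on a nontrivial row space is the square of a nonzero
  singular value, so it is at least \<open>\<sigma>\<^sub>m\<^sub>i\<^sub>n\<^sup>2\<close>.
\<close>

lemma sigma_min_lower_bound:
  fixes A :: "real^'n^'m"
  assumes w: "w \<in> row_space A"
  shows "(sigma_min A)\<^sup>2 * (norm w)\<^sup>2 \<le> (norm (A *v w))\<^sup>2"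
proof (cases "row_space A = {0}")
  case True
  then show ?thesis using w by simp
next
  case False
  then obtain v c where v: "norm v = 1" "c > 0" "transpose A *v (A *v v) = c *\<^sub>R v"
      and le: "c * (norm w)\<^sup>2 \<le> (norm (A *v w))\<^sup>2"
    using rayleigh_minimum_is_eigenvalue w by metis
  let ?S = "{s. singular_value A s \<and> s \<noteq> 0}"
  have "v \<noteq> 0" using v(1) by auto
  then have S: "sqrt c \<in> ?S"
    using v by (auto simp: singular_value_def matrix_vector_mul_assoc)
  then have "sigma_min A \<le> sqrt c" "sigma_min A \<in> ?S"
    unfolding sigma_min_def using finite_singular_values[of A] Min_le Min_in[of ?S] by blast+
  then have "(sigma_min A)\<^sup>2 \<le> (sqrt c)\<^sup>2"
    by (intro power_mono) (auto simp: singular_value_def)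
  then have "(sigma_min A)\<^sup>2 * (norm w)\<^sup>2 \<le> c * (norm w)\<^sup>2"
    using v(2) by (intro mult_right_mono) auto
  with le show ?thesis by linarith
qed

lemma frobenius_norm_rows: "(frobenius_norm A)\<^sup>2 = (\<Sum>i\<in>UNIV. (norm (row i A))\<^sup>2)"
  unfolding frobenius_norm_def power2_norm_eq_inner inner_vec_def
  by (simp add: sum_nonneg row_def power2_eq_square)

lemma norm_mult_rows:
  fixes A :: "real^'n^'m"
  shows "(norm (A *v v))\<^sup>2 = (\<Sum>i\<in>UNIV. (row i A \<bullet> v)\<^sup>2)"
proof -
  have "row i A \<bullet> v = (A *v v) $ i" for i
    by (simp add: matrix_vector_mul_component row_def vec_lambda_eta)
  then show ?thesis
    unfolding power2_norm_eq_inner inner_vec_def[of "A *v v"] by (simp add: power2_eq_square)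
qed

text \<open>
  Bessel's inequality for two orthonormal vectors: the distance from \<open>a\<close> to the plane that they
  span has a nonnegative square.
\<close>

lemma bessel_two:
  fixes a u v :: "'a::real_inner"
  assumes "norm u = 1" "norm v = 1" "u \<bullet> v = 0"
  shows "(a \<bullet> u)\<^sup>2 + (a \<bullet> v)\<^sup>2 \<le> (norm a)\<^sup>2"
proof -
  have "u \<bullet> u = 1" "v \<bullet> v = 1" using assms by (simp_all add: dot_square_norm)
  have "0 \<le> (norm (a - (a \<bullet> u) *\<^sub>R u - (a \<bullet> v) *\<^sub>R v))\<^sup>2" by simp
  also have "\<dots> = (norm a)\<^sup>2 - (a \<bullet> u)\<^sup>2 - (a \<bullet> v)\<^sup>2"
    using assms(3) \<open>u \<bullet> u = 1\<close> \<open>v \<bullet> v = 1\<close>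
    unfolding power2_norm_eq_inner
    by (simp add: inner_simps inner_commute[of u a] inner_commute[of v a]
        inner_commute[of v u] power2_eq_square algebra_simps)
  finally show ?thesis by simp
qed

text \<open>
  A space of dimension at least 2 meets every hyperplane nontrivially. This is what rank at
  least 2 provides.
\<close>

lemma unit_vector_orthogonal_in_row_space:
  fixes A :: "real^'n^'m"
  assumes "rank A \<ge> 2"
  obtains w where "w \<in> row_space A" "norm w = 1" "u \<bullet> w = 0"
proof -
  let ?W = "row_space A"
  have dim_W: "dim ?W = rank A"
    unfolding row_space_def rank_dim_range[symmetric] by (rule rank_transpose)
  have "\<exists>w \<in> ?W. w \<noteq> 0 \<and> u \<bullet> w = 0"
  proof (cases "\<exists>w0\<in>?W. u \<bullet> w0 \<noteq> 0")
    case True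
    then obtain w0 where w0: "w0 \<in> ?W" "u \<bullet> w0 \<noteq> 0" by blast
    have "\<not> ?W \<subseteq> span {w0}"
    proof
      assume "?W \<subseteq> span {w0}"
      then have "dim ?W \<le> dim {w0}" by (rule dim_subset[THEN order_trans]) (simp add: dim_span)
      also have "\<dots> \<le> 1" by (simp add: dim_singleton)
      finally show False using dim_W assms by linarith
    qed
    then obtain z where z: "z \<in> ?W" "z \<notin> span {w0}" by blast
    let ?w = "z - ((u \<bullet> z) / (u \<bullet> w0)) *\<^sub>R w0"
    have "?w \<in> ?W" using z(1) w0(1)
      by (intro subspace_diff[OF subspace_row_space] subspace_mul[OF subspace_row_space])
    moreover have "?w \<noteq> 0" using z(2) by (auto simp: span_singleton)
    moreover have "u \<bullet> ?w = 0" using w0(2) by (simp add: inner_diff_right)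
    ultimately show ?thesis by blast
  next
    case False
    have "\<not> ?W \<subseteq> {0}"
      using dim_W assms dim_eq_0[of ?W] by auto
    then show ?thesis using False by blast
  qed
  then obtain w where w: "w \<in> ?W" "w \<noteq> 0" "u \<bullet> w = 0" by blast
  show thesis
  proof (rule that)
    show "(1 / norm w) *\<^sub>R w \<in> ?W" using w by (intro subspace_mul[OF subspace_row_space])
  qed (use w in auto)
qed

text \<open>
  For a unit vector \<open>u\<close>, choose a unit vector \<open>w\<close> of the row space orthogonal to \<open>u\<close>. Bessel's
  inequality on each row of \<open>A\<close> gives \<open>\<parallel>A u\<parallel>\<^sup>2 + \<parallel>A w\<parallel>\<^sup>2 \<le> \<parallel>A\<parallel>\<^sub>F\<^sup>2\<close>, and the second term is at
  least \<open>\<sigma>\<^sub>m\<^sub>i\<^sub>n\<^sup>2\<close>.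
\<close>

lemma rank_two_upper_bound:
  fixes A :: "real^'n^'m"
  assumes rk: "rank A \<ge> 2"
  shows "(norm (A *v v))\<^sup>2 \<le> ((frobenius_norm A)\<^sup>2 - (sigma_min A)\<^sup>2) * (norm v)\<^sup>2"
proof (cases "v = 0")
  case False
  define u where "u = (1 / norm v) *\<^sub>R v"
  have u: "norm u = 1" "v = norm v *\<^sub>R u" using False by (auto simp: u_def)
  obtain w where w: "w \<in> row_space A" "norm w = 1" "u \<bullet> w = 0"
    using unit_vector_orthogonal_in_row_space[OF rk] by blast
  have "(norm (A *v u))\<^sup>2 + (norm (A *v w))\<^sup>2 \<le> (frobenius_norm A)\<^sup>2"
    unfolding norm_mult_rows frobenius_norm_rows sum.distrib[symmetric]
    using u(1) w(2,3) by (intro sum_mono bessel_two)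
  moreover have "(sigma_min A)\<^sup>2 \<le> (norm (A *v w))\<^sup>2"
    using sigma_min_lower_bound[OF w(1)] w(2) by simp
  ultimately have "(norm (A *v u))\<^sup>2 \<le> (frobenius_norm A)\<^sup>2 - (sigma_min A)\<^sup>2" by linarith
  then have "(norm v)\<^sup>2 * (norm (A *v u))\<^sup>2 \<le> (norm v)\<^sup>2 * ((frobenius_norm A)\<^sup>2 - (sigma_min A)\<^sup>2)"
    by (rule mult_left_mono) simp
  moreover have "norm (A *v v) = norm v * norm (A *v u)"
    by (subst u(2)) (simp add: matrix_vector_mult_scaleR)
  ultimately show ?thesis by (simp add: power_mult_distrib mult.commute)
qed simp

section \<open>The mean reflection\<close>

text \<open>
  For a symmetric operator the bound on the quadratic form bounds the norm, by polarization:
  \<open>4 (S v \<bullet> w)\<close> is the difference of the forms at \<open>v + w\<close> and \<open>v - w\<close>, and the parallelogram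
  law bounds it in terms of \<open>\<parallel>v\<parallel>\<close> and \<open>\<parallel>w\<parallel>\<close>. The best \<open>w\<close> is the multiple of \<open>S v\<close> with the
  length of \<open>v\<close>.
\<close>

lemma symmetric_operator_norm_le:
  fixes S :: "'a::real_inner \<Rightarrow> 'a"
  assumes W: "subspace W" and lin: "linear S" and inv: "\<And>v. v \<in> W \<Longrightarrow> S v \<in> W"
    and sym: "\<And>u v. S u \<bullet> v = u \<bullet> S v"
    and form: "\<And>v. v \<in> W \<Longrightarrow> \<bar>S v \<bullet> v\<bar> \<le> c * (norm v)\<^sup>2"
    and v: "v \<in> W"
  shows "norm (S v) \<le> c * norm v"
proof (cases "S v = 0 \<or> v = 0")
  case True
  moreover have "0 \<le> c * norm v"
  proof (cases "v = 0")
    case False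
    have "0 \<le> c * (norm v)\<^sup>2" using form[OF v] by linarith
    then show ?thesis using False by (simp add: zero_le_mult_iff)
  qed simp
  ultimately show ?thesis using linear_0[OF lin] by auto
next
  case False
  define w where "w = (norm v / norm (S v)) *\<^sub>R S v"
  have wW: "w \<in> W" unfolding w_def using W inv[OF v] by (rule subspace_mul)
  have nw: "norm w = norm v" using False by (simp add: w_def)
  have "4 * (S v \<bullet> w) = S (v + w) \<bullet> (v + w) - S (v - w) \<bullet> (v - w)"
    using sym[of w v]
    by (simp add: linear_add[OF lin] linear_diff[OF lin] inner_simps inner_commute[of w "S v"])
  also have "\<dots> \<le> c * (norm (v + w))\<^sup>2 + c * (norm (v - w))\<^sup>2"
    using form[OF subspace_add[OF W v wW]] form[OF subspace_diff[OF W v wW]] by linarith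
  also have "\<dots> = 2 * c * (norm v)\<^sup>2 + 2 * c * (norm w)\<^sup>2"
    by (simp add: power2_norm_eq_inner inner_simps inner_commute[of w v] algebra_simps)
  finally have "S v \<bullet> w \<le> c * (norm v)\<^sup>2" by (simp add: nw)
  moreover have "S v \<bullet> w = norm v * norm (S v)"
    using False by (simp add: w_def dot_square_norm power2_eq_square)
  ultimately show ?thesis using False by (simp add: power2_eq_square)
qed

text \<open>
  The expectation of the reflection in the hyperplane orthogonal to a randomly selected row.
\<close>

definition mean_reflection :: "real^'n^'m \<Rightarrow> real^'n \<Rightarrow> real^'n" where
  "mean_reflection A v = v - (2 / (frobenius_norm A)\<^sup>2) *\<^sub>R (transpose A *v (A *v v))"

definition contraction_factor :: "real^'n^'m \<Rightarrow> real" where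
  "contraction_factor A = 1 - 2 * ((sigma_min A)\<^sup>2 / (frobenius_norm A)\<^sup>2)"

lemma linear_mean_reflection: "linear (mean_reflection A)"
  by (rule linearI) (simp_all add: mean_reflection_def matrix_vector_right_distrib
      matrix_vector_mult_scaleR algebra_simps)

lemma mean_reflection_symmetric: "mean_reflection A u \<bullet> v = u \<bullet> mean_reflection A v"
proof -
  have "(transpose A *v (A *v u)) \<bullet> v = u \<bullet> (transpose A *v (A *v v))"
    by (metis transpose_inner inner_commute)
  then show ?thesis by (simp add: mean_reflection_def inner_diff_left inner_diff_right)
qed

lemma mean_reflection_row_space:
  "v \<in> row_space A \<Longrightarrow> mean_reflection A v \<in> row_space A"
  unfolding mean_reflection_def
  by (intro subspace_diff[OF subspace_row_space] subspace_mul[OF subspace_row_space]) simp_all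

lemma frobenius_norm_pos:
  fixes A :: "real^'n^'m"
  assumes "rank A \<ge> 2" shows "0 < (frobenius_norm A)\<^sup>2"
proof -
  obtain w where w: "w \<in> row_space A" "norm w = 1"
    using unit_vector_orthogonal_in_row_space[OF assms, of 0] by blast
  then have "w \<noteq> 0" by auto
  then have "A *v w \<noteq> 0" using w(1) row_space_kernel_trivial by blast
  then have "0 < (norm (A *v w))\<^sup>2" by simp
  also have "\<dots> \<le> (frobenius_norm A)\<^sup>2 - (sigma_min A)\<^sup>2"
    using rank_two_upper_bound[OF assms, of w] w(2) by simp
  finally show ?thesis using zero_le_power2[of "sigma_min A"] by linarith
qed

text \<open>
  Evaluating the lower and the upper bound for \<open>\<parallel>A w\<parallel>\<^sup>2\<close> at one unit vector \<open>w\<close> of the row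
  space gives \<open>2 \<sigma>\<^sub>m\<^sub>i\<^sub>n\<^sup>2 \<le> \<parallel>A\<parallel>\<^sub>F\<^sup>2\<close>.
\<close>

lemma contraction_factor_nonneg:
  fixes A :: "real^'n^'m"
  assumes "rank A \<ge> 2" shows "0 \<le> contraction_factor A"
proof -
  obtain w where w: "w \<in> row_space A" "norm w = 1"
    using unit_vector_orthogonal_in_row_space[OF assms, of 0] by blast
  have "2 * (sigma_min A)\<^sup>2 \<le> (frobenius_norm A)\<^sup>2"
    using rank_two_upper_bound[OF assms, of w] sigma_min_lower_bound[OF w(1)] w(2) by simp
  then show ?thesis using frobenius_norm_pos[OF assms] by (simp add: contraction_factor_def)
qed

text \<open>
  On the row space \<open>\<parallel>A v\<parallel>\<^sup>2\<close> lies between \<open>\<sigma>\<^sub>m\<^sub>i\<^sub>n\<^sup>2 \<parallel>v\<parallel>\<^sup>2\<close> and \<open>(\<parallel>A\<parallel>\<^sub>F\<^sup>2 - \<sigma>\<^sub>m\<^sub>i\<^sub>n\<^sup>2) \<parallel>v\<parallel>\<^sup>2\<close>. The map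
  \<open>s \<mapsto> 1 - 2 s / \<parallel>A\<parallel>\<^sub>F\<^sup>2\<close> sends this range to an interval symmetric about 0, whose right end is
  the contraction factor. So the upper bound excludes a large negative eigenvalue of the mean.
\<close>

lemma norm_mean_reflection_le:
  fixes A :: "real^'n^'m"
  assumes rk: "rank A \<ge> 2" and v: "v \<in> row_space A"
  shows "norm (mean_reflection A v) \<le> contraction_factor A * norm v"
proof (rule symmetric_operator_norm_le[OF subspace_row_space linear_mean_reflection
      mean_reflection_row_space mean_reflection_symmetric _ v])
  fix v assume v: "v \<in> row_space A"
  let ?F = "(frobenius_norm A)\<^sup>2" and ?s = "(sigma_min A)\<^sup>2"
  have F: "0 < ?F" by (rule frobenius_norm_pos[OF rk])
  have "mean_reflection A v \<bullet> v = (norm v)\<^sup>2 - 2 * (norm (A *v v))\<^sup>2 / ?F"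
    by (simp add: mean_reflection_def inner_diff_left transpose_inner power2_norm_eq_inner)
  moreover have "?s * (norm v)\<^sup>2 / ?F \<le> (norm (A *v v))\<^sup>2 / ?F"
    using sigma_min_lower_bound[OF v] F by (intro divide_right_mono) auto
  moreover have "(norm (A *v v))\<^sup>2 / ?F \<le> (?F - ?s) * (norm v)\<^sup>2 / ?F"
    using rank_two_upper_bound[OF rk, of v] F by (intro divide_right_mono) auto
  moreover have "(?F - ?s) * (norm v)\<^sup>2 / ?F = (norm v)\<^sup>2 - ?s * (norm v)\<^sup>2 / ?F"
    using F by (simp add: field_simps)
  ultimately show "\<bar>mean_reflection A v \<bullet> v\<bar> \<le> contraction_factor A * (norm v)\<^sup>2"
    unfolding contraction_factor_def by (auto simp: algebra_simps abs_le_iff)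
qed

lemma norm_mean_reflection_power_le:
  fixes A :: "real^'n^'m"
  assumes rk: "rank A \<ge> 2" and v: "v \<in> row_space A"
  shows "norm ((mean_reflection A ^^ l) v) \<le> contraction_factor A ^ l * norm v"
proof -
  have "(mean_reflection A ^^ l) v \<in> row_space A
      \<and> norm ((mean_reflection A ^^ l) v) \<le> contraction_factor A ^ l * norm v"
  proof (induction l)
    case (Suc l)
    let ?z = "(mean_reflection A ^^ l) v"
    have "norm (mean_reflection A ?z) \<le> contraction_factor A * norm ?z"
      using Suc by (intro norm_mean_reflection_le[OF rk]) auto
    also have "\<dots> \<le> contraction_factor A * (contraction_factor A ^ l * norm v)"
      using Suc contraction_factor_nonneg[OF rk] by (intro mult_left_mono) auto
    finally show ?case using Suc mean_reflection_row_space by auto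
  qed (simp add: v)
  then show ?thesis by blast
qed

section \<open>Averaging out an independent selection\<close>

text \<open>
  Dependence on a set of coordinates, as a pointwise property: it passes to compositions without
  side conditions, and factoring through the joint map of finitely many coordinates turns it
  into measurability and independence.
\<close>

definition determined_by :: "('i \<Rightarrow> 'w \<Rightarrow> 'c) \<Rightarrow> 'i set \<Rightarrow> ('w \<Rightarrow> 'd) \<Rightarrow> bool" where
  "determined_by X I U \<longleftrightarrow> (\<forall>w w'. (\<forall>p\<in>I. X p w = X p w') \<longrightarrow> U w = U w')"

lemma determined_by_const: "determined_by X I (\<lambda>_. c)"
  by (simp add: determined_by_def)

lemma determined_by_coordinate: "p \<in> I \<Longrightarrow> determined_by X I (X p)"
  by (simp add: determined_by_def)

lemma determined_by_mono: "determined_by X I U \<Longrightarrow> I \<subseteq> I' \<Longrightarrow> determined_by X I' U"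
  unfolding determined_by_def by blast

lemma determined_by_compose: "determined_by X I U \<Longrightarrow> determined_by X I (\<lambda>w. f (U w))"
  unfolding determined_by_def by metis

lemma determined_by_compose2:
  "determined_by X I U \<Longrightarrow> determined_by X I V \<Longrightarrow> determined_by X I (\<lambda>w. f (U w) (V w))"
  unfolding determined_by_def by metis

lemma determined_by_factors:
  assumes "determined_by X I G"
  obtains g where "\<And>w. G w = g (restrict (\<lambda>p. X p w) I)"
proof
  fix w
  let ?w' = "SOME w'. \<forall>p\<in>I. X p w' = restrict (\<lambda>p. X p w) I p"
  have "\<forall>p\<in>I. X p ?w' = restrict (\<lambda>p. X p w) I p" by (rule someI[of _ w]) simp
  then have "\<forall>p\<in>I. X p w = X p ?w'" by simp
  \<comment> \<open>The factor chooses any sample point realizing the given coordinate values.\<close>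
  then show "G w = (\<lambda>f. G (SOME w'. \<forall>p\<in>I. X p w' = f p)) (restrict (\<lambda>p. X p w) I)"
    using assms unfolding determined_by_def by blast
qed

context prob_space
begin

text \<open>
  Such a function is measurable and takes finitely many values, since finitely many coordinates
  with values in a finite type have only finitely many joint values.
\<close>

lemma integrable_determined_by:
  fixes X :: "'i \<Rightarrow> 'a \<Rightarrow> 'c::finite" and G :: "'a \<Rightarrow> real"
  assumes meas: "\<And>p. p \<in> I \<Longrightarrow> X p \<in> measurable M (count_space UNIV)"
    and fin: "finite I" and det: "determined_by X I G"
  shows "integrable M G"
proof -
  obtain g where g: "\<And>w. G w = g (restrict (\<lambda>p. X p w) I)"
    using determined_by_factors[OF det] by metis
  let ?P = "PiE I (\<lambda>_. UNIV :: 'c set)"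
  have P: "PiM I (\<lambda>_. count_space (UNIV :: 'c set)) = count_space ?P"
    using fin by (intro count_space_PiM_finite) (auto intro: countable_finite)
  have "(\<lambda>w. restrict (\<lambda>p. X p w) I) \<in> measurable M (PiM I (\<lambda>_. count_space UNIV))"
    using meas by (intro measurable_restrict)
  moreover have "g \<in> borel_measurable (count_space ?P)" by simp
  ultimately have "G \<in> borel_measurable M"
    unfolding P using measurable_compose g by (metis (no_types, lifting) ext)
  moreover have "finite ?P" using fin by (intro finite_PiE) auto
  then have "finite (range G)"
    by (rule finite_surj[of _ _ g]) (auto simp: g)
  then have "bounded (range G)" by (rule finite_imp_bounded)
  then obtain B where "\<And>w. norm (G w) \<le> B" unfolding bounded_iff by auto
  ultimately show ?thesis by (intro integrable_const_bound[of _ B]) auto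
qed

text \<open>
  The selection at \<open>p\<close> is independent of the joint selections in \<open>I\<close>, so the expectation of the
  product factorizes.
\<close>

lemma expectation_indicator_times_determined:
  fixes X :: "'i \<Rightarrow> 'a \<Rightarrow> 'c::finite" and G :: "'a \<Rightarrow> real"
  assumes ind: "indep_vars (\<lambda>_. count_space UNIV) X K"
    and I: "I \<subseteq> K" "finite I" and p: "p \<in> K" "p \<notin> I" and det: "determined_by X I G"
  shows "expectation (\<lambda>w. indicator {i} (X p w) * G w)
       = prob {w \<in> space M. X p w = i} * expectation G"
proof -
  have meas: "X q \<in> measurable M (count_space UNIV)" if "q \<in> K" for q
    using ind that by (auto simp: indep_vars_def)
  obtain g where g: "\<And>w. G w = g (restrict (\<lambda>p. X p w) I)"
    using determined_by_factors[OF det] by metis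
  have P: "PiM I (\<lambda>_. count_space (UNIV :: 'c set)) = count_space (PiE I (\<lambda>_. UNIV))"
    using I(2) by (intro count_space_PiM_finite) (auto intro: countable_finite)
  let ?c = "\<lambda>f. indicator {i} (f p) :: real"
  have "indep_var (PiM {p} (\<lambda>_. count_space UNIV)) (\<lambda>w. restrict (\<lambda>q. X q w) {p})
      (PiM I (\<lambda>_. count_space UNIV)) (\<lambda>w. restrict (\<lambda>q. X q w) I)"
    using p I(1) by (intro indep_var_restrict[OF ind]) auto
  then have "indep_var borel (?c \<circ> (\<lambda>w. restrict (\<lambda>q. X q w) {p}))
      borel (g \<circ> (\<lambda>w. restrict (\<lambda>q. X q w) I))"
  proof (rule indep_var_compose)
    show "?c \<in> borel_measurable (PiM {p} (\<lambda>_. count_space UNIV))"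
      by (rule measurable_compose[OF measurable_component_singleton]) auto
    show "g \<in> borel_measurable (PiM I (\<lambda>_. count_space UNIV))" unfolding P by simp
  qed
  then have iv: "indep_var borel (\<lambda>w. indicator {i} (X p w) :: real) borel G"
    by (simp add: comp_def g[symmetric])
  have "integrable M (\<lambda>w. indicator {i} (X p w) :: real)"
    using meas[OF p(1)] determined_by_compose[OF determined_by_coordinate[of p "{p}" X]]
    by (intro integrable_determined_by[of "{p}" X]) auto
  moreover have "integrable M G"
    using meas I by (intro integrable_determined_by[OF _ I(2) det]) auto
  ultimately have "expectation (\<lambda>w. indicator {i} (X p w) * G w)
      = expectation (\<lambda>w. indicator {i} (X p w)) * expectation G"
    by (intro indep_var_lebesgue_integral[OF iv])
  also have "expectation (\<lambda>w. indicator {i} (X p w) :: real)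
      = expectation (indicator {w \<in> space M. X p w = i})"
    by (intro Bochner_Integration.integral_cong) (auto simp: indicator_def)
  also have "\<dots> = prob {w \<in> space M. X p w = i}"
    by (simp, rule arg_cong[where f = prob], auto)
  finally show ?thesis .
qed

text \<open>
  Averaging out the newest selection, in place of a conditional expectation given the selections
  in \<open>I\<close>: decompose \<open>h (X p)\<close> according to the value of \<open>X p\<close>.
\<close>

lemma expectation_of_fresh_selection:
  fixes X :: "'i \<Rightarrow> 'a \<Rightarrow> 'c::finite" and h :: "'c \<Rightarrow> 'a \<Rightarrow> real"
  assumes ind: "indep_vars (\<lambda>_. count_space UNIV) X K"
    and I: "I \<subseteq> K" "finite I" and p: "p \<in> K" "p \<notin> I"
    and det: "\<And>i. determined_by X I (h i)"
  shows "expectation (\<lambda>w. h (X p w) w)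
       = expectation (\<lambda>w. \<Sum>i\<in>UNIV. prob {w \<in> space M. X p w = i} * h i w)"
proof -
  have meas: "X q \<in> measurable M (count_space UNIV)" if "q \<in> K" for q
    using ind that by (auto simp: indep_vars_def)
  have int: "integrable M (h i)" for i
    using meas I by (intro integrable_determined_by[OF _ I(2) det]) auto
  have int': "integrable M (\<lambda>w. indicator {i} (X p w) * h i w)" for i
  proof (rule integrable_determined_by)
    show "determined_by X (insert p I) (\<lambda>w. indicator {i} (X p w) * h i w)"
      by (rule determined_by_compose2[OF determined_by_coordinate
            determined_by_mono[OF det]]) auto
  qed (use meas I p in auto)
  have split: "h (X p w) w = (\<Sum>i\<in>UNIV. indicator {i} (X p w) * h i w)" for w
    by (simp add: indicator_def if_distrib[of "\<lambda>x. x * _"] cong: if_cong)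
  have "expectation (\<lambda>w. h (X p w) w)
      = (\<Sum>i\<in>UNIV. expectation (\<lambda>w. indicator {i} (X p w) * h i w))"
    unfolding split using int' by (intro Bochner_Integration.integral_sum) auto
  also have "\<dots> = (\<Sum>i\<in>UNIV. prob {w \<in> space M. X p w = i} * expectation (h i))"
    by (intro sum.cong refl expectation_indicator_times_determined[OF ind I p det])
  also have "\<dots> = expectation (\<lambda>w. \<Sum>i\<in>UNIV. prob {w \<in> space M. X p w = i} * h i w)"
    using int by (simp add: Bochner_Integration.integral_sum)
  finally show ?thesis .
qed

end

section \<open>Reflection of errors\<close>

text \<open>
  The hyperplane \<open>\<langle>a\<^sub>i, x\<rangle> = b\<^sub>i\<close> passes through \<open>xs\<close>, so the error is reflected in the
  parallel hyperplane through the origin, which is the case \<open>b = 0\<close>.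
\<close>

lemma row_reflection_error:
  fixes A :: "real^'n^'m"
  assumes "A *v xs = b"
  shows "row_reflection A b i z - xs = row_reflection A 0 i (z - xs)"
proof -
  have "b $ i = row i A \<bullet> xs"
    by (simp add: assms[symmetric] matrix_vector_mul_component row_def vec_lambda_eta)
  then show ?thesis by (simp add: row_reflection_def inner_diff_right)
qed

lemma inner_iterate_error:
  fixes A :: "real^'n^'m"
  assumes "A *v xs = b"
  shows "inner_iterate A b js z l - xs = inner_iterate A 0 js (z - xs) l"
  by (induction l) (simp_all add: row_reflection_error[OF assms])

lemma norm_row_reflection: "norm (row_reflection A 0 i z) = norm z"
proof (cases "row i A = 0")
  case False
  let ?a = "row i A"
  let ?t = "2 * (?a \<bullet> z / (norm ?a)\<^sup>2)"
  have "(norm (row_reflection A 0 i z))\<^sup>2 = (z - ?t *\<^sub>R ?a) \<bullet> (z - ?t *\<^sub>R ?a)"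
    by (simp add: row_reflection_def power2_norm_eq_inner)
  also have "\<dots> = (norm z)\<^sup>2 - 2 * ?t * (?a \<bullet> z) + ?t\<^sup>2 * (norm ?a)\<^sup>2"
    unfolding power2_norm_eq_inner
    by (simp add: inner_diff_left inner_diff_right inner_commute[of z ?a] power2_eq_square)
  also have "\<dots> = (norm z)\<^sup>2"
    using False by (simp add: power2_eq_square field_simps)
  finally show ?thesis by simp
qed (simp add: row_reflection_def)

lemma norm_inner_iterate: "norm (inner_iterate A 0 js z l) = norm z"
  by (induction l) (simp_all add: norm_row_reflection)

lemma inner_iterate_row_space:
  assumes "z \<in> row_space A"
  shows "inner_iterate A 0 js z l \<in> row_space A"
proof (induction l)
  case (Suc l)
  then show ?case
    by (auto simp: row_reflection_def intro!: subspace_diff[OF subspace_row_space]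
        subspace_mul[OF subspace_row_space] row_in_row_space)
qed (simp add: assms)

text \<open>
  The weight \<open>\<parallel>a\<^sub>i\<parallel>\<^sup>2\<close> cancels the denominator of the reflection, so the weighted sum of the
  rank-one terms is \<open>A\<^sup>T A\<close>. A zero row has weight 0, and its reflection is the identity by the
  convention for division by 0.
\<close>

lemma mean_reflection_eq_average:
  fixes A :: "real^'n^'m"
  assumes F: "0 < (frobenius_norm A)\<^sup>2"
  shows "(\<Sum>i\<in>UNIV. ((norm (row i A))\<^sup>2 / (frobenius_norm A)\<^sup>2) * (row_reflection A 0 i z \<bullet> v))
       = mean_reflection A z \<bullet> v"
proof -
  let ?F = "(frobenius_norm A)\<^sup>2"
  have summand: "((norm (row i A))\<^sup>2 / ?F) * (row_reflection A 0 i z \<bullet> v)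
      = (norm (row i A))\<^sup>2 * ((z \<bullet> v) / ?F) - (2 / ?F) * ((row i A \<bullet> z) * (row i A \<bullet> v))" for i
  proof (cases "row i A = 0")
    case False
    \<comment> \<open>Stated for scalars, so that the squared norms stay atomic.\<close>
    have "N / G * (p - 2 * (x / N) * y) = N * (p / G) - 2 / G * (x * y)"
      if "N \<noteq> 0" "G \<noteq> 0" for N G p x y :: real
      using that by (simp add: field_simps)
    from this[of "(norm (row i A))\<^sup>2" ?F "z \<bullet> v" "row i A \<bullet> z" "row i A \<bullet> v"]
    show ?thesis using False F by (simp add: row_reflection_def inner_diff_left)
  qed simp
  have row: "row i A \<bullet> u = (A *v u) $ i" for i u
    by (simp add: matrix_vector_mul_component row_def vec_lambda_eta)
  have "(\<Sum>i\<in>UNIV. (row i A \<bullet> z) * (row i A \<bullet> v)) = (A *v z) \<bullet> (A *v v)"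
    unfolding row by (simp add: inner_vec_def[of "A *v z"])
  then have "(\<Sum>i\<in>UNIV. ((norm (row i A))\<^sup>2 / ?F) * (row_reflection A 0 i z \<bullet> v))
      = ?F * ((z \<bullet> v) / ?F) - (2 / ?F) * ((A *v z) \<bullet> (A *v v))"
    unfolding summand sum_subtractf sum_distrib_left[symmetric] sum_distrib_right[symmetric]
    by (simp add: frobenius_norm_rows)
  also have "\<dots> = mean_reflection A z \<bullet> v"
    using F by (simp add: mean_reflection_def inner_diff_left transpose_inner)
  finally show ?thesis .
qed

section \<open>The error recursion\<close>

definition past :: "nat \<Rightarrow> nat \<Rightarrow> (nat \<times> nat) set" where
  "past r k = {1..<k} \<times> {1..r}"

lemma past_mono: "k \<le> k' \<Longrightarrow> past r k \<subseteq> past r k'"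
  by (auto simp: past_def)

lemma inner_iterate_determined_by:
  assumes U: "determined_by (\<lambda>(k, l). J k l) I U"
  shows "determined_by (\<lambda>(k, l). J k l) (I \<union> {k} \<times> {1..l})
           (\<lambda>w. inner_iterate A b (\<lambda>l. J k l w) (U w) l)"
proof (induction l)
  case 0
  then show ?case using U by simp
next
  case (Suc l)
  have "determined_by (\<lambda>(k, l). J k l) (I \<union> {k} \<times> {1..Suc l})
      (\<lambda>w. row_reflection A b ((\<lambda>(k, l). J k l) (k, Suc l) w)
        (inner_iterate A b (\<lambda>l. J k l w) (U w) l))"
    by (rule determined_by_compose2[OF determined_by_coordinate determined_by_mono[OF Suc.IH]]) auto
  then show ?case by simp
qed

lemma mRrDR_determined_by:
  "determined_by (\<lambda>(k, l). J k l) (past r k)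
     (\<lambda>w. mRrDR A b r \<alpha> \<beta> x0 x1 (\<lambda>i l. J i l w) k)"
proof (induction k rule: induct_nat_012)
  case (ge2 k)
  let ?X = "\<lambda>(k, l). J k l" and ?x = "\<lambda>k w. mRrDR A b r \<alpha> \<beta> x0 x1 (\<lambda>i l. J i l w) k"
  have "past r (Suc k) \<union> {Suc k} \<times> {1..r} = past r (Suc (Suc k))"
    by (auto simp: past_def)
  then have z: "determined_by ?X (past r (Suc (Suc k)))
      (\<lambda>w. inner_iterate A b (\<lambda>l. J (Suc k) l w) (?x (Suc k) w) r)"
    using inner_iterate_determined_by[OF ge2(2), of "Suc k" r] by simp
  have x: "determined_by ?X (past r (Suc (Suc k))) (?x (Suc k))"
          "determined_by ?X (past r (Suc (Suc k))) (?x k)"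
    using ge2 by (auto elim!: determined_by_mono intro!: past_mono)
  show ?case
    using determined_by_compose2[OF determined_by_compose2[OF x] z,
        where f = "\<lambda>(x, y) z. (1 - \<alpha>) *\<^sub>R x + \<alpha> *\<^sub>R z + \<beta> *\<^sub>R (x - y)" and f1 = Pair]
    by (simp add: Let_def)
qed (simp_all add: determined_by_const)

text \<open>
  In mean, \<open>l\<close> random reflections act as the \<open>l\<close>-th power of the mean reflection, also against a
  test vector \<open>V\<close> that depends on the past. The induction replaces the last reflection by its
  mean and moves it by symmetry onto \<open>V\<close>, so \<open>V\<close> varies in the induction.
\<close>

lemma (in prob_space) expectation_inner_iterate:
  fixes A :: "real^'n^'m" and J :: "nat \<Rightarrow> nat \<Rightarrow> 'a \<Rightarrow> 'm"
  assumes F: "0 < (frobenius_norm A)\<^sup>2"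
    and ind: "indep_vars (\<lambda>_. count_space UNIV) (\<lambda>(k, l). J k l) ({1..} \<times> {1..r})"
    and law: "\<And>k l i. k \<ge> 1 \<Longrightarrow> l \<in> {1..r} \<Longrightarrow>
       prob {w \<in> space M. J k l w = i} = (norm (row i A))\<^sup>2 / (frobenius_norm A)\<^sup>2"
    and k: "k \<ge> 1" and l: "l \<le> r"
    and U: "determined_by (\<lambda>(k, l). J k l) (past r k) U"
    and V: "determined_by (\<lambda>(k, l). J k l) (past r k) V"
  shows "expectation (\<lambda>w. inner_iterate A 0 (\<lambda>l. J k l w) (U w) l \<bullet> V w)
       = expectation (\<lambda>w. U w \<bullet> (mean_reflection A ^^ l) (V w))"
  using l V
proof (induction l arbitrary: V)
  case (Suc l)
  let ?X = "\<lambda>(k, l). J k l"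
  let ?I = "past r k \<union> {k} \<times> {1..l}"
  let ?z = "\<lambda>w. inner_iterate A 0 (\<lambda>l. J k l w) (U w) l"
  have z: "determined_by ?X ?I ?z" by (rule inner_iterate_determined_by[OF U])
  have V': "determined_by ?X ?I V" using Suc.prems(2) by (rule determined_by_mono) auto
  have "expectation (\<lambda>w. row_reflection A 0 (?X (k, Suc l) w) (?z w) \<bullet> V w)
      = expectation (\<lambda>w. \<Sum>i\<in>UNIV. prob {w \<in> space M. ?X (k, Suc l) w = i}
          * (row_reflection A 0 i (?z w) \<bullet> V w))"
  proof (rule expectation_of_fresh_selection[OF ind])
    show "?I \<subseteq> {1..} \<times> {1..r}" using k Suc.prems(1) by (auto simp: past_def)
    show "finite ?I" by (simp add: past_def)
    show "(k, Suc l) \<in> {1..} \<times> {1..r}" using k Suc.prems(1) by auto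
    show "(k, Suc l) \<notin> ?I" by (auto simp: past_def)
    show "determined_by ?X ?I (\<lambda>w. row_reflection A 0 i (?z w) \<bullet> V w)" for i
      by (rule determined_by_compose2[OF z V'])
  qed
  also have "\<dots> = expectation (\<lambda>w. ?z w \<bullet> mean_reflection A (V w))"
    using k Suc.prems(1) law[of k "Suc l"]
    by (simp only: mean_reflection_eq_average[OF F] mean_reflection_symmetric prod.case
        atLeastAtMost_iff le_add1 plus_1_eq_Suc simp_thms Suc_le_eq zero_less_Suc)
  also have "\<dots> = expectation (\<lambda>w. U w \<bullet> (mean_reflection A ^^ l) (mean_reflection A (V w)))"
    using Suc.prems(1) by (intro Suc.IH determined_by_compose[OF Suc.prems(2)]) simp
  finally show ?case by (simp add: funpow_swap1)
qed simp

text \<open>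
  The inner loop preserves the norm, so \<open>\<parallel>t\<parallel>\<close> does not appear, and \<open>t\<close> enters only linearly, in
  the last two terms.
\<close>

lemma momentum_norm_expansion:
  fixes u v t :: "'a::real_inner"
  assumes "norm t = norm u"
  shows "(norm ((1 - \<alpha>) *\<^sub>R u + \<alpha> *\<^sub>R t + \<beta> *\<^sub>R (u - v)))\<^sup>2
    = ((1 - \<alpha> + \<beta>)\<^sup>2 + \<alpha>\<^sup>2) * (norm u)\<^sup>2 + \<beta>\<^sup>2 * (norm v)\<^sup>2 - 2 * \<beta> * (1 - \<alpha> + \<beta>) * (u \<bullet> v)
      + 2 * \<alpha> * (1 - \<alpha> + \<beta>) * (t \<bullet> u) - 2 * \<alpha> * \<beta> * (t \<bullet> v)"
proof -
  have tt: "t \<bullet> t = u \<bullet> u" using assms by (simp add: norm_eq)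
  have "(1 - \<alpha>) *\<^sub>R u + \<alpha> *\<^sub>R t + \<beta> *\<^sub>R (u - v) = (1 - \<alpha> + \<beta>) *\<^sub>R u + \<alpha> *\<^sub>R t - \<beta> *\<^sub>R v"
    by (simp add: algebra_simps)
  then show ?thesis
    unfolding power2_norm_eq_inner
    by (simp add: inner_add_left inner_add_right inner_diff_left inner_diff_right tt
        inner_commute[of u t] inner_commute[of v u] inner_commute[of v t]
        power2_eq_square algebra_simps)
qed

text \<open>
  With \<open>t\<close> replaced by its mean in the expansion, Cauchy-Schwarz bounds the inner products and
  \<open>2 \<parallel>u\<parallel> \<parallel>v\<parallel> \<le> \<parallel>u\<parallel>\<^sup>2 + \<parallel>v\<parallel>\<^sup>2\<close> separates \<open>u\<close> from \<open>v\<close>. The coefficients that result are \<open>\<gamma>\<^sub>1\<close> and \<open>\<gamma>\<^sub>2\<close>. The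
  vector \<open>Sv\<close> is paired with \<open>u\<close> because the mean operator has been moved by symmetry.
\<close>

lemma momentum_mean_bound:
  fixes u v Su Sv :: "'a::real_inner"
  assumes ab: "0 \<le> \<alpha>" "\<alpha> \<le> 1" "0 \<le> \<beta>" and \<rho>: "0 \<le> \<rho>"
    and Su: "norm Su \<le> \<rho> * norm u" and Sv: "norm Sv \<le> \<rho> * norm v"
  shows "((1 - \<alpha> + \<beta>)\<^sup>2 + \<alpha>\<^sup>2) * (norm u)\<^sup>2 + \<beta>\<^sup>2 * (norm v)\<^sup>2 - 2 * \<beta> * (1 - \<alpha> + \<beta>) * (u \<bullet> v)
      + 2 * \<alpha> * (1 - \<alpha> + \<beta>) * (u \<bullet> Su) - 2 * \<alpha> * \<beta> * (u \<bullet> Sv)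
    \<le> (\<alpha>\<^sup>2 + (1 - \<alpha>)\<^sup>2 + (2 * \<alpha> * (1 - \<alpha>) + 3 * \<alpha> * \<beta>) * \<rho> + 2 * \<beta>\<^sup>2 + 3 * (1 - \<alpha>) * \<beta>) * (norm u)\<^sup>2
      + (2 * \<beta>\<^sup>2 + (1 - \<alpha>) * \<beta> + \<alpha> * \<beta> * \<rho>) * (norm v)\<^sup>2"
proof -
  define N where "N = ((norm u)\<^sup>2 + (norm v)\<^sup>2) / 2"
  have N: "norm u * norm v \<le> N"
    using sum_squares_bound[of "norm u" "norm v"] by (simp add: N_def)
  have 1: "- (u \<bullet> v) \<le> N"
    using Cauchy_Schwarz_ineq2[of u v] N by linarith
  have "u \<bullet> Su \<le> norm u * norm Su" by (rule norm_cauchy_schwarz)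
  also have "\<dots> \<le> norm u * (\<rho> * norm u)" by (intro mult_left_mono Su) simp
  finally have 2: "u \<bullet> Su \<le> \<rho> * (norm u)\<^sup>2" by (simp add: power2_eq_square mult_ac)
  have "- (u \<bullet> Sv) \<le> norm u * norm Sv" using Cauchy_Schwarz_ineq2[of u Sv] by linarith
  also have "\<dots> \<le> norm u * (\<rho> * norm v)" by (intro mult_left_mono Sv) simp
  also have "\<dots> \<le> \<rho> * N" using mult_left_mono[OF N \<rho>] by (simp add: mult_ac)
  finally have 3: "- (u \<bullet> Sv) \<le> \<rho> * N" .
  have "2 * \<beta> * (1 - \<alpha> + \<beta>) * - (u \<bullet> v) \<le> 2 * \<beta> * (1 - \<alpha> + \<beta>) * N"
    using ab by (intro mult_left_mono 1) auto
  moreover have "2 * \<alpha> * (1 - \<alpha> + \<beta>) * (u \<bullet> Su) \<le> 2 * \<alpha> * (1 - \<alpha> + \<beta>) * (\<rho> * (norm u)\<^sup>2)"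
    using ab by (intro mult_left_mono 2) auto
  moreover have "2 * \<alpha> * \<beta> * - (u \<bullet> Sv) \<le> 2 * \<alpha> * \<beta> * (\<rho> * N)"
    using ab by (intro mult_left_mono 3) auto
  ultimately have "((1 - \<alpha> + \<beta>)\<^sup>2 + \<alpha>\<^sup>2) * (norm u)\<^sup>2 + \<beta>\<^sup>2 * (norm v)\<^sup>2 - 2 * \<beta> * (1 - \<alpha> + \<beta>) * (u \<bullet> v)
      + 2 * \<alpha> * (1 - \<alpha> + \<beta>) * (u \<bullet> Su) - 2 * \<alpha> * \<beta> * (u \<bullet> Sv)
    \<le> ((1 - \<alpha> + \<beta>)\<^sup>2 + \<alpha>\<^sup>2) * (norm u)\<^sup>2 + \<beta>\<^sup>2 * (norm v)\<^sup>2 + 2 * \<beta> * (1 - \<alpha> + \<beta>) * N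
      + 2 * \<alpha> * (1 - \<alpha> + \<beta>) * (\<rho> * (norm u)\<^sup>2) + 2 * \<alpha> * \<beta> * (\<rho> * N)"
    by linarith
  also have "\<dots> = (\<alpha>\<^sup>2 + (1 - \<alpha>)\<^sup>2 + (2 * \<alpha> * (1 - \<alpha>) + 3 * \<alpha> * \<beta>) * \<rho> + 2 * \<beta>\<^sup>2 + 3 * (1 - \<alpha>) * \<beta>) * (norm u)\<^sup>2
      + (2 * \<beta>\<^sup>2 + (1 - \<alpha>) * \<beta> + \<alpha> * \<beta> * \<rho>) * (norm v)\<^sup>2"
    unfolding N_def by (simp add: power2_eq_square field_simps)
  finally show ?thesis .
qed

text \<open>
  The errors stay in the row space and the two latest ones are determined by the past, so in the
  expanded square every inner product with the outcome of the inner loop may be replaced, in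
  expectation, by one with a power of the mean reflection. The rest is the pointwise bound.
\<close>

lemma (in prob_space) expected_error_recursion:
  fixes A :: "real^'n^'m" and J :: "nat \<Rightarrow> nat \<Rightarrow> 'a \<Rightarrow> 'm"
    and b :: "real^'m" and r :: nat and \<alpha> \<beta> :: real and x0 x1 xs :: "real^'n"
  defines "e \<equiv> \<lambda>k w. mRrDR A b r \<alpha> \<beta> x0 x1 (\<lambda>i l. J i l w) k - xs"
    and "\<rho> \<equiv> contraction_factor A ^ r"
  assumes rk: "rank A \<ge> 2" and xs: "A *v xs = b"
    and x01: "x0 - xs \<in> row_space A" "x1 - xs \<in> row_space A"
    and ab: "0 \<le> \<alpha>" "\<alpha> \<le> 1" "0 \<le> \<beta>"
    and ind: "indep_vars (\<lambda>_. count_space UNIV) (\<lambda>(k, l). J k l) ({1..} \<times> {1..r})"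
    and law: "\<And>k l i. k \<ge> 1 \<Longrightarrow> l \<in> {1..r} \<Longrightarrow>
       prob {w \<in> space M. J k l w = i} = (norm (row i A))\<^sup>2 / (frobenius_norm A)\<^sup>2"
  shows "integrable M (\<lambda>w. (norm (e k w))\<^sup>2)"
    and "expectation (\<lambda>w. (norm (e (Suc (Suc k)) w))\<^sup>2)
      \<le> (\<alpha>\<^sup>2 + (1 - \<alpha>)\<^sup>2 + (2 * \<alpha> * (1 - \<alpha>) + 3 * \<alpha> * \<beta>) * \<rho> + 2 * \<beta>\<^sup>2 + 3 * (1 - \<alpha>) * \<beta>)
          * expectation (\<lambda>w. (norm (e (Suc k) w))\<^sup>2)
        + (2 * \<beta>\<^sup>2 + (1 - \<alpha>) * \<beta> + \<alpha> * \<beta> * \<rho>) * expectation (\<lambda>w. (norm (e k w))\<^sup>2)"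
proof -
  let ?X = "\<lambda>(k, l). J k l"
  let ?S = "mean_reflection A ^^ r"
  have meas: "?X p \<in> measurable M (count_space UNIV)" if "p \<in> past r k" for p k
    using ind that by (auto simp: indep_vars_def past_def)
  have int: "integrable M G" if "determined_by ?X (past r k) G" for k and G :: "'a \<Rightarrow> real"
    using meas that by (intro integrable_determined_by[of "past r k" ?X]) (auto simp: past_def)
  have e: "determined_by ?X (past r k) (e k)" for k
    unfolding e_def by (rule determined_by_compose[OF mRrDR_determined_by])
  show int_e: "integrable M (\<lambda>w. (norm (e k w))\<^sup>2)" for k
    by (rule int[OF determined_by_compose[OF e]])
  define t where "t w = inner_iterate A 0 (\<lambda>l. J (Suc k) l w) (e (Suc k) w) r" for w
  have step: "e (Suc (Suc k)) w = (1 - \<alpha>) *\<^sub>R e (Suc k) w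
      + \<alpha> *\<^sub>R inner_iterate A 0 (\<lambda>l. J (Suc k) l w) (e (Suc k) w) r
      + \<beta> *\<^sub>R (e (Suc k) w - e k w)" for k w
    by (simp add: e_def Let_def inner_iterate_error[OF xs, symmetric] algebra_simps)
  have W: "e k w \<in> row_space A" for k w
  proof (induction k rule: induct_nat_012)
    case (ge2 k)
    then show ?case unfolding step
      by (intro subspace_add[OF subspace_row_space] subspace_mul[OF subspace_row_space]
          subspace_diff[OF subspace_row_space] inner_iterate_row_space)
  qed (use x01 in \<open>simp_all add: e_def\<close>)
  let ?u = "e (Suc k)" and ?v = "e k"
  let ?a = "(1 - \<alpha> + \<beta>)\<^sup>2 + \<alpha>\<^sup>2" and ?b = "\<beta>\<^sup>2" and ?c = "2 * \<beta> * (1 - \<alpha> + \<beta>)"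
    and ?d = "2 * \<alpha> * (1 - \<alpha> + \<beta>)" and ?f = "2 * \<alpha> * \<beta>"
  have v: "determined_by ?X (past r (Suc k)) ?v"
    using e by (rule determined_by_mono) (simp add: past_mono)
  have t: "determined_by ?X (past r (Suc (Suc k))) t"
    unfolding t_def
    by (rule determined_by_mono[OF inner_iterate_determined_by[OF e]]) (auto simp: past_def)
  have u': "determined_by ?X (past r (Suc (Suc k))) ?u"
    and v': "determined_by ?X (past r (Suc (Suc k))) ?v"
    by (rule determined_by_mono[OF e], simp add: past_mono)+
  note ints = int_e int[OF determined_by_compose2[OF e v]] int[OF determined_by_compose2[OF t u']]
    int[OF determined_by_compose2[OF t v']] int[OF determined_by_compose2[OF e e]]
  have iv: "integrable M (\<lambda>w. ?u w \<bullet> ?S (?v w))" "integrable M (\<lambda>w. ?u w \<bullet> ?S (?u w))"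
    by (rule ints)+
  have mean: "expectation (\<lambda>w. t w \<bullet> V w) = expectation (\<lambda>w. ?u w \<bullet> ?S (V w))"
    if "determined_by ?X (past r (Suc k)) V" for V
    unfolding t_def
    by (rule expectation_inner_iterate[OF frobenius_norm_pos[OF rk] ind law _ order_refl e that]) auto
  have "expectation (\<lambda>w. (norm (e (Suc (Suc k)) w))\<^sup>2) = expectation (\<lambda>w.
      ?a * (norm (?u w))\<^sup>2 + ?b * (norm (?v w))\<^sup>2 - ?c * (?u w \<bullet> ?v w)
      + ?d * (t w \<bullet> ?u w) - ?f * (t w \<bullet> ?v w))"
    unfolding step t_def by (simp add: momentum_norm_expansion norm_inner_iterate)
  also have "\<dots> = ?a * expectation (\<lambda>w. (norm (?u w))\<^sup>2) + ?b * expectation (\<lambda>w. (norm (?v w))\<^sup>2)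
      - ?c * expectation (\<lambda>w. ?u w \<bullet> ?v w)
      + ?d * expectation (\<lambda>w. t w \<bullet> ?u w) - ?f * expectation (\<lambda>w. t w \<bullet> ?v w)"
    by (simp add: ints)
  also have "\<dots> = ?a * expectation (\<lambda>w. (norm (?u w))\<^sup>2) + ?b * expectation (\<lambda>w. (norm (?v w))\<^sup>2)
      - ?c * expectation (\<lambda>w. ?u w \<bullet> ?v w)
      + ?d * expectation (\<lambda>w. ?u w \<bullet> ?S (?u w)) - ?f * expectation (\<lambda>w. ?u w \<bullet> ?S (?v w))"
    by (simp only: mean[OF e] mean[OF v])
  also have "\<dots> = expectation (\<lambda>w.
      ?a * (norm (?u w))\<^sup>2 + ?b * (norm (?v w))\<^sup>2 - ?c * (?u w \<bullet> ?v w)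
      + ?d * (?u w \<bullet> ?S (?u w)) - ?f * (?u w \<bullet> ?S (?v w)))"
    by (simp add: ints iv)
  also have "\<dots> \<le> expectation (\<lambda>w.
      (\<alpha>\<^sup>2 + (1 - \<alpha>)\<^sup>2 + (2 * \<alpha> * (1 - \<alpha>) + 3 * \<alpha> * \<beta>) * \<rho> + 2 * \<beta>\<^sup>2 + 3 * (1 - \<alpha>) * \<beta>) * (norm (?u w))\<^sup>2
      + (2 * \<beta>\<^sup>2 + (1 - \<alpha>) * \<beta> + \<alpha> * \<beta> * \<rho>) * (norm (?v w))\<^sup>2)"
  proof (rule integral_mono)
    have "0 \<le> \<rho>" unfolding \<rho>_def using contraction_factor_nonneg[OF rk] by simp
    then show "?a * (norm (?u w))\<^sup>2 + ?b * (norm (?v w))\<^sup>2 - ?c * (?u w \<bullet> ?v w)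
      + ?d * (?u w \<bullet> ?S (?u w)) - ?f * (?u w \<bullet> ?S (?v w))
      \<le> (\<alpha>\<^sup>2 + (1 - \<alpha>)\<^sup>2 + (2 * \<alpha> * (1 - \<alpha>) + 3 * \<alpha> * \<beta>) * \<rho> + 2 * \<beta>\<^sup>2 + 3 * (1 - \<alpha>) * \<beta>) * (norm (?u w))\<^sup>2
      + (2 * \<beta>\<^sup>2 + (1 - \<alpha>) * \<beta> + \<alpha> * \<beta> * \<rho>) * (norm (?v w))\<^sup>2" for w
      unfolding \<rho>_def by (intro momentum_mean_bound ab norm_mean_reflection_power_le[OF rk W])
  qed (simp_all add: ints iv)
  also have "\<dots> = (\<alpha>\<^sup>2 + (1 - \<alpha>)\<^sup>2 + (2 * \<alpha> * (1 - \<alpha>) + 3 * \<alpha> * \<beta>) * \<rho> + 2 * \<beta>\<^sup>2 + 3 * (1 - \<alpha>) * \<beta>)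
          * expectation (\<lambda>w. (norm (e (Suc k) w))\<^sup>2)
        + (2 * \<beta>\<^sup>2 + (1 - \<alpha>) * \<beta> + \<alpha> * \<beta> * \<rho>) * expectation (\<lambda>w. (norm (e k w))\<^sup>2)"
    by (simp add: ints)
  finally show "expectation (\<lambda>w. (norm (e (Suc (Suc k)) w))\<^sup>2)
      \<le> (\<alpha>\<^sup>2 + (1 - \<alpha>)\<^sup>2 + (2 * \<alpha> * (1 - \<alpha>) + 3 * \<alpha> * \<beta>) * \<rho> + 2 * \<beta>\<^sup>2 + 3 * (1 - \<alpha>) * \<beta>)
          * expectation (\<lambda>w. (norm (e (Suc k) w))\<^sup>2)
        + (2 * \<beta>\<^sup>2 + (1 - \<alpha>) * \<beta> + \<alpha> * \<beta> * \<rho>) * expectation (\<lambda>w. (norm (e k w))\<^sup>2)" .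
qed

section \<open>Linear convergence of the expected error\<close>

theorem theorem4p1:
  fixes A :: "real^'n^'m" and b :: "real^'m" and x0 x1 xs :: "real^'n"
    and r :: nat and \<alpha> \<beta> \<gamma>1 \<gamma>2 q \<tau> :: real
    and M :: "'w measure" and J :: "nat \<Rightarrow> nat \<Rightarrow> 'w \<Rightarrow> 'm"
  assumes "rank A \<ge> 2"
    and "\<exists>x. A *v x = b"
    and "r \<ge> 1"
    and "x1 = x0"
    and "0 < \<alpha>" and "\<alpha> < 1" and "\<beta> \<ge> 0"
    and "row_selections M A r J"
    and "xs = pseudoinverse A *v b + (mat 1 - pseudoinverse A ** A) *v x0"
    and "\<gamma>1 = \<alpha>\<^sup>2 + (1 - \<alpha>)\<^sup>2
           + (2 * \<alpha> * (1 - \<alpha>) + 3 * \<alpha> * \<beta>)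
               * (1 - 2 * ((sigma_min A)\<^sup>2 / (frobenius_norm A)\<^sup>2)) ^ r
           + 2 * \<beta>\<^sup>2 + 3 * (1 - \<alpha>) * \<beta>"
    and "\<gamma>2 = 2 * \<beta>\<^sup>2 + (1 - \<alpha>) * \<beta>
           + \<alpha> * \<beta> * (1 - 2 * ((sigma_min A)\<^sup>2 / (frobenius_norm A)\<^sup>2)) ^ r"
    and "\<gamma>1 + \<gamma>2 < 1"
    and "q = (\<gamma>1 + sqrt (\<gamma>1\<^sup>2 + 4 * \<gamma>2)) / 2"
    and "\<tau> = q - \<gamma>1"
  shows "(\<forall>k. integrable M
                (\<lambda>w. (norm (mRrDR A b r \<alpha> \<beta> x0 x1 (\<lambda>i l. J i l w) (k + 1) - xs))\<^sup>2)
            \<and> prob_space.expectation M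
                (\<lambda>w. (norm (mRrDR A b r \<alpha> \<beta> x0 x1 (\<lambda>i l. J i l w) (k + 1) - xs))\<^sup>2)
              \<le> q ^ k * (1 + \<tau>) * (norm (x0 - xs))\<^sup>2)
         \<and> \<tau> \<ge> 0 \<and> \<gamma>1 + \<gamma>2 \<le> q \<and> q < 1"
proof -
  interpret prob_space M using assms(8) by (simp add: row_selections_def)
  have ind: "indep_vars (\<lambda>_. count_space UNIV) (\<lambda>(k, l). J k l) ({1..} \<times> {1..r})"
    and law: "\<And>k l i. k \<ge> 1 \<Longrightarrow> l \<in> {1..r} \<Longrightarrow>
       prob {w \<in> space M. J k l w = i} = (norm (row i A))\<^sup>2 / (frobenius_norm A)\<^sup>2"
    using assms(8) by (simp_all add: row_selections_def)
  note xs = pseudoinverse_projection[OF assms(2,9)]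
  define \<rho> where "\<rho> = contraction_factor A ^ r"
  have \<rho>: "0 \<le> \<rho>" unfolding \<rho>_def using contraction_factor_nonneg[OF assms(1)] by simp
  note g1 = assms(10)[folded contraction_factor_def, folded \<rho>_def]
  note g2 = assms(11)[folded contraction_factor_def, folded \<rho>_def]
  have "0 < \<alpha>\<^sup>2" "0 \<le> (1 - \<alpha>)\<^sup>2" "0 \<le> (2 * \<alpha> * (1 - \<alpha>) + 3 * \<alpha> * \<beta>) * \<rho>"
    "0 \<le> 2 * \<beta>\<^sup>2" "0 \<le> 3 * (1 - \<alpha>) * \<beta>"
    using assms(5-7) \<rho> by simp_all
  then have g1_pos: "0 < \<gamma>1" unfolding g1 by linarith
  have g2_nonneg: "0 \<le> \<gamma>2" unfolding g2 using assms(5-7) \<rho> by simp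
  note q = dominant_root[OF g1_pos g2_nonneg assms(12,13)]
  have \<tau>: "q * \<tau> = \<gamma>2" "0 \<le> \<tau>" using q(1,2) unfolding assms(14) by simp_all
  let ?E = "\<lambda>k. expectation (\<lambda>w. (norm (mRrDR A b r \<alpha> \<beta> x0 x1 (\<lambda>i l. J i l w) k - xs))\<^sup>2)"
  have x1: "x1 - xs \<in> row_space A" using xs(2) assms(4) by simp
  note recursion = expected_error_recursion[OF assms(1) xs x1 less_imp_le[OF assms(5)]
      less_imp_le[OF assms(6)] assms(7) ind]
  have int: "integrable M (\<lambda>w. (norm (mRrDR A b r \<alpha> \<beta> x0 x1 (\<lambda>i l. J i l w) k - xs))\<^sup>2)" for k
    by (rule recursion(1)[OF law])
  have rec: "?E (Suc (Suc k)) \<le> \<gamma>1 * ?E (Suc k) + \<gamma>2 * ?E k" for k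
    unfolding g1 g2 \<rho>_def by (rule recursion(2)[OF law])
  have bound: "?E (Suc k) \<le> q ^ k * (?E 1 + \<tau> * ?E 0)" for k
    using two_term_recursion_bound[where F = ?E, OF rec _ _ \<tau>(2) assms(14) \<tau>(1)] g1_pos q(2)
    by simp
  have start: "?E 1 = (norm (x0 - xs))\<^sup>2" "?E 0 = (norm (x0 - xs))\<^sup>2"
    using assms(4) by (simp_all add: prob_space)
  have "?E (k + 1) \<le> q ^ k * (1 + \<tau>) * (norm (x0 - xs))\<^sup>2" for k
    using bound[of k, unfolded start] by (simp add: algebra_simps)
  then show ?thesis using int \<tau>(2) q(3,4) by blast
qed

end
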